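(* There is an absolute constant $K$ such that the following holds. Let $A\subseteq\mathbb{R}^2$ be a finite set with $|A|\ge2$ and density $m$, let $s\ge1$, $\sigma=\{0,1,\ldots,s\}$, let $\chi\colon A\to\sigma$ be any coloring, and write $A_j=\chi^{-1}(j)$. Then the number of regions ($2$-dimensional cells) of the overlay $\mathrm{Ovl}\{\mathrm{Vor}(A_j): j\in\sigma\}$ is at most $K s^2 m^2$, i.e. $O(s^2m^2)$.
   Context: The density of a finite set is the maximum distance between two of its points divided by the minimum distance between two of its points. $\mathrm{Vor}(A_j)$ is the Voronoi tessellation of $A_j$. The overlay $\mathrm{Ovl}\{\mathrm{Vor}(A_j): j\in\sigma\}$ is the decomposition of $\mathbb{R}^2$ obtained by drawing the edges and vertices of all the $\mathrm{Vor}(A_j)$ on top of each other; its regions are the intersections $\nu_0\cap\cdots\cap\nu_s$ with non-empty interior, $\nu_j$ a Voronoi domain of $A_j$. *)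

theory Defs
  imports "HOL-Analysis.Analysis"
begin

definition distances :: "(real^2) set \<Rightarrow> real set" where
  "distances A = {dist x y | x y. x \<in> A \<and> y \<in> A \<and> x \<noteq> y}"

definition point_density :: "(real^2) set \<Rightarrow> real" where
  "point_density A = Max (distances A) / Min (distances A)"

definition voronoi_domain :: "(real^2) set \<Rightarrow> real^2 \<Rightarrow> (real^2) set" where
  "voronoi_domain B a = {x. \<forall>b\<in>B. dist x a \<le> dist x b}"

text \<open>
  A colour class may be empty.  The Voronoi tessellation of the empty set has no edges and no
  vertices, so the whole plane is its only region and it contributes nothing to an overlay.
\<close>

definition Vor :: "(real^2) set \<Rightarrow> (real^2) set set" where
  "Vor B = (if B = {} then {UNIV} else voronoi_domain B ` B)"

definition overlay_regions :: "nat set \<Rightarrow> (nat \<Rightarrow> (real^2) set set) \<Rightarrow> (real^2) set set" where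
  "overlay_regions I T =
     {R. \<exists>\<nu>. (\<forall>j\<in>I. \<nu> j \<in> T j) \<and> R = (\<Inter>j\<in>I. \<nu> j) \<and> interior R \<noteq> {}}"

definition color_class :: "(real^2) set \<Rightarrow> (real^2 \<Rightarrow> nat) \<Rightarrow> nat \<Rightarrow> (real^2) set" where
  "color_class A c j = {a \<in> A. c a = j}"

end

theory Submission
  imports Defs
begin

text \<open>
  By Helly's theorem, the point of a planar intersection of convex sets that is closest to the origin
  is already the closest point of the intersection of two of the sets. Hence a region of the overlay
  is determined by two of its cells, and it remains to bound, for two colour classes \<open>P\<close> and \<open>Q\<close>,
  the number of pairs of cells that meet by \<open>O(m\<^sup>2)\<close>. Let the smallest distance be \<open>1\<close>.

  If \<open>x\<close> lies in the cell of \<open>a\<close>, then the half of the segment from \<open>a\<close> to \<open>x\<close> next to \<open>a\<close> has distance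
  at least \<open>1/4\<close> from the boundary of the cell. By packing, only \<open>O(r)\<close> sites at distance about \<open>r\<close>
  have cells that reach a given disc of radius \<open>r\<close>. In particular \<open>O(m)\<close> cells per class reach
  beyond distance \<open>2m\<close>, which settles the pairs of cells that meet far away. For a pair \<open>a \<in> P\<close>,
  \<open>b \<in> Q\<close> whose cells meet at a nearer point \<open>x\<close> with \<open>r = |x - a| \<le> |x - b|\<close>, charge \<open>1/r\<close> to each of
  about \<open>r\<close> squares of a fine grid, namely those visited next to \<open>x\<close> by the segment from \<open>b\<close> to \<open>x\<close>
  after scaling it by \<open>1/2\<close> towards \<open>b\<close>. Such a square determines \<open>b\<close>. Since the distance to \<open>P\<close> is
  Lipschitz, all pairs charging a square have comparable \<open>r\<close>, so there are \<open>O(r)\<close> of them and the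
  square receives total charge \<open>O(1)\<close>. There are \<open>O(m\<^sup>2)\<close> squares.
\<close>

subsection \<open>Overlays of convex tessellations\<close>

text \<open>Helly's theorem for the given sets together with the open ball around \<open>z\<close> whose boundary
  passes through the closest point.\<close>

lemma closest_point_Inter_two:
  fixes C :: "'i \<Rightarrow> (real^2) set" and z :: "real^2"
  assumes "I \<noteq> {}" and conv: "\<And>i. i \<in> I \<Longrightarrow> convex (C i)"
    and cl: "\<And>i. i \<in> I \<Longrightarrow> closed (C i)" and ne: "(\<Inter>i\<in>I. C i) \<noteq> {}" and fin: "finite I"
  shows "\<exists>i\<in>I. \<exists>j\<in>I. closest_point (\<Inter>k\<in>I. C k) z = closest_point (C i \<inter> C j) z"
proof -
  define X where "X = (\<Inter>k\<in>I. C k)"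
  define p where "p = closest_point X z"
  define B where "B = ball z (dist z p)"
  have X: "closed X" "X \<noteq> {}"
    using cl ne by (auto simp: X_def)
  then have p: "p \<in> X" and pmin: "\<And>y. y \<in> X \<Longrightarrow> dist z p \<le> dist z y"
    unfolding p_def by (auto simp: closest_point_in_set closest_point_le)
  have "\<exists>i\<in>I. \<exists>j\<in>I. C i \<inter> C j \<inter> B = {}"
  proof (rule ccontr)
    assume "\<not> ?thesis"
    then have meet: "\<And>i j. i \<in> I \<Longrightarrow> j \<in> I \<Longrightarrow> C i \<inter> C j \<inter> B \<noteq> {}"
      by blast
    define f where "f = insert B (C ` I)"
    \<comment> \<open>In the plane Helly's theorem asks for triples. A triple without
      \<open>B\<close> contains \<open>X\<close> in its intersection; a triple with \<open>B\<close>
      leaves at most two of the sets \<open>C i\<close>, which meet inside \<open>B\<close> by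
      assumption.\<close>
    have sub: "\<Inter>t \<noteq> {}" if t: "t \<subseteq> f" "card t \<le> 3" "finite t" for t
    proof (cases "B \<in> t")
      case False
      then have "X \<subseteq> \<Inter>t"
        using t by (auto simp: f_def X_def)
      then show ?thesis using X by auto
    next
      case True
      then have c: "card (t - {B}) \<le> 2" and s: "t - {B} \<subseteq> C ` I"
        using t by (auto simp: f_def)
      have "\<exists>i\<in>I. \<exists>j\<in>I. t - {B} \<subseteq> {C i, C j}"
      proof (cases "t - {B} = {}")
        case True
        then show ?thesis using \<open>I \<noteq> {}\<close> by blast
      next
        case False
        then obtain y where y: "y \<in> t - {B}" by blast
        have c1: "card (t - {B} - {y}) \<le> 1" using c y t by (simp add: card_Diff_singleton)
        show ?thesis
        proof (cases "t - {B} - {y} = {}")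
          case True
          then show ?thesis using y s by (metis Diff_eq_empty_iff imageE insert_iff subset_iff)
        next
          case False
          then obtain w where "t - {B} - {y} = {w}"
            using c1 t
            by (metis card_le_Suc0_iff_eq One_nat_def finite_Diff is_singletonE is_singletonI')
          then have "t - {B} = {y, w}" using y by blast
          then show ?thesis using s by (metis imageE insert_subset order_refl)
        qed
      qed
      then obtain i j where "i \<in> I" "j \<in> I" "t - {B} \<subseteq> {C i, C j}" by blast
      moreover from this(3) have "C i \<inter> C j \<inter> B \<subseteq> \<Inter>t" by auto
      ultimately show ?thesis using meet by blast
    qed
    have ff: "finite f" using fin by (simp add: f_def)
    have "\<Inter>f \<noteq> {}"
    proof (cases "card f \<le> 3")
      case True
      then show ?thesis using sub ff by blast
    next
      case False
      show ?thesis
      proof (rule Helly)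
        show "card f \<ge> DIM(real^2) + 1" using False by simp
        show "\<forall>s\<in>f. convex s" using conv by (auto simp: f_def B_def)
        fix t assume t: "t \<subseteq> f" "card t = DIM(real^2) + 1"
        then show "\<Inter>t \<noteq> {}" using sub[of t] ff finite_subset by auto
      qed
    qed
    then obtain y where y: "y \<in> X" "y \<in> B"
      by (auto simp: f_def X_def)
    then show False using pmin[of y] by (simp add: B_def)
  qed
  then obtain i j where ij: "i \<in> I" "j \<in> I" "C i \<inter> C j \<inter> B = {}" by blast
  have "p = closest_point (C i \<inter> C j) z"
  proof (rule closest_point_unique)
    show "convex (C i \<inter> C j)" "closed (C i \<inter> C j)"
      using ij conv cl by (auto intro: convex_Int)
    show "p \<in> C i \<inter> C j" using p ij by (auto simp: X_def)
    show "\<forall>y\<in>C i \<inter> C j. dist z p \<le> dist z y"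
      using ij(3) by (force simp: B_def)
  qed
  then show ?thesis using ij by (auto simp: p_def X_def)
qed

text \<open>Each region is encoded by two indices together with its cells at these indices, chosen
  so that they already fix the point closest to the origin. The two cells meet because both contain
  the region. The sum includes \<open>i = j\<close>, since the two indices may coincide.\<close>

lemma overlay_regions_card_le:
  assumes fin: "finite I" and ne: "I \<noteq> {}"
    and finT: "\<And>j. j \<in> I \<Longrightarrow> finite (T j)"
    and conv: "\<And>j v. j \<in> I \<Longrightarrow> v \<in> T j \<Longrightarrow> convex v"
    and disj: "\<And>j v w. j \<in> I \<Longrightarrow> v \<in> T j \<Longrightarrow> w \<in> T j \<Longrightarrow> v \<noteq> w \<Longrightarrow> interior v \<inter> interior w = {}"
  shows "finite (overlay_regions I T)"
    and "card (overlay_regions I T)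
      \<le> (\<Sum>(i, j)\<in>I \<times> I. card {(v, w). v \<in> T i \<and> w \<in> T j \<and> v \<inter> w \<noteq> {}})"
proof -
  define O1 where "O1 = overlay_regions I T"
  have "O1 \<subseteq> (\<lambda>v. \<Inter>j\<in>I. v j) ` Pi\<^sub>E I T"
  proof
    fix R assume "R \<in> O1"
    then obtain v where v: "\<forall>j\<in>I. v j \<in> T j" "R = (\<Inter>j\<in>I. v j)"
      by (auto simp: O1_def overlay_regions_def)
    then have "restrict v I \<in> Pi\<^sub>E I T" "R = (\<Inter>j\<in>I. restrict v I j)" by auto
    then show "R \<in> (\<lambda>v. \<Inter>j\<in>I. v j) ` Pi\<^sub>E I T" by blast
  qed
  then have finO: "finite O1"
    using fin finT by (meson finite_PiE finite_imageI finite_subset)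
  then show "finite (overlay_regions I T)" by (simp add: O1_def)
  have "\<forall>R\<in>O1. \<exists>v. (\<forall>j\<in>I. v j \<in> T j) \<and> R = (\<Inter>j\<in>I. v j) \<and> interior R \<noteq> {}"
    by (auto simp: O1_def overlay_regions_def)
  from bchoice[OF this] obtain v where
    vall: "\<forall>R\<in>O1. (\<forall>j\<in>I. v R j \<in> T j) \<and> R = (\<Inter>j\<in>I. v R j) \<and> interior R \<noteq> {}"
    by blast
  have v: "\<And>R j. R \<in> O1 \<Longrightarrow> j \<in> I \<Longrightarrow> v R j \<in> T j"
      "\<And>R. R \<in> O1 \<Longrightarrow> R = (\<Inter>j\<in>I. v R j)" "\<And>R. R \<in> O1 \<Longrightarrow> interior R \<noteq> {}"
    using bspec[OF vall] by (blast, (elim meta_allE conjE, simp)+)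
  then have "\<forall>R\<in>O1. \<exists>x. x \<in> interior R" by blast
  then obtain x where x: "\<And>R. R \<in> O1 \<Longrightarrow> x R \<in> interior R" by metis
  \<comment> \<open>Shrinking the cells to hulls of finitely many interior points makes the cells of one tessellation
    disjoint, so that distinct regions have distinct points closest to the origin.\<close>
  define C where "C j w = convex hull (x ` {R \<in> O1. v R j = w})" for j w
  have Cint: "C j w \<subseteq> interior w" if "j \<in> I" "w \<in> T j" for j w
    unfolding C_def
  proof (rule hull_minimal)
    show "convex (interior w)" using conv that by simp
    show "x ` {R \<in> O1. v R j = w} \<subseteq> interior w"
    proof clarify
      fix R assume R: "R \<in> O1" "w = v R j"
      then have "R \<subseteq> v R j" using v(2)[of R] that by blast
      then show "x R \<in> interior (v R j)" using x R interior_mono by blast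
    qed
  qed
  define X where "X R = (\<Inter>j\<in>I. C j (v R j))" for R
  have xX: "x R \<in> X R" if "R \<in> O1" for R
    using that by (auto simp: X_def C_def intro!: hull_inc)
  have Xdisj: "X R \<inter> X S = {}" if "R \<in> O1" "S \<in> O1" "R \<noteq> S" for R S
  proof -
    have "\<exists>j\<in>I. v R j \<noteq> v S j"
    proof (rule ccontr)
      assume "\<not> ?thesis"
      then have "(\<Inter>j\<in>I. v R j) = (\<Inter>j\<in>I. v S j)" by auto
      then show False using v(2)[OF that(1)] v(2)[OF that(2)] that(3) by order
    qed
    then obtain j where j: "j \<in> I" "v R j \<noteq> v S j" by blast
    then have "C j (v R j) \<inter> C j (v S j) = {}"
      using Cint[of j "v R j"] Cint[of j "v S j"] disj[of j "v R j" "v S j"] v(1) that by blast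
    then show ?thesis using j by (auto simp: X_def)
  qed
  have Cc: "convex (C j w)" "compact (C j w)" for j w
    using finO by (auto simp: C_def intro!: finite_imp_compact_convex_hull)
  have "\<forall>R\<in>O1. \<exists>q. q \<in> I \<times> I \<and>
      closest_point (X R) 0 = closest_point (C (fst q) (v R (fst q)) \<inter> C (snd q) (v R (snd q))) 0"
  proof
    fix R assume "R \<in> O1"
    then have "(\<Inter>j\<in>I. C j (v R j)) \<noteq> {}" using xX[of R] unfolding X_def by blast
    from closest_point_Inter_two[OF ne _ _ this fin, of 0]
    obtain i j where "i \<in> I" "j \<in> I"
        "closest_point (X R) 0 = closest_point (C i (v R i) \<inter> C j (v R j)) 0"
      using Cc unfolding X_def by (auto simp: compact_imp_closed)
    then show "\<exists>q. q \<in> I \<times> I \<and>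
      closest_point (X R) 0 = closest_point (C (fst q) (v R (fst q)) \<inter> C (snd q) (v R (snd q))) 0"
      by (intro exI[of _ "(i, j)"]) auto
  qed
  from bchoice[OF this] obtain q where q: "\<And>R. R \<in> O1 \<Longrightarrow> q R \<in> I \<times> I"
     "\<And>R. R \<in> O1 \<Longrightarrow> closest_point (X R) 0 =
        closest_point (C (fst (q R)) (v R (fst (q R))) \<inter> C (snd (q R)) (v R (snd (q R)))) 0"
    by blast
  \<comment> \<open>Regions with equal codes share the closest point of their shrunken versions
    \<open>X R\<close>, but these are disjoint for distinct regions.\<close>
  define g where "g R = (q R, v R (fst (q R)), v R (snd (q R)))" for R
  have inj: "inj_on g O1"
  proof (rule inj_onI, rule ccontr)
    fix R S assume RS: "R \<in> O1" "S \<in> O1" "g R = g S" "R \<noteq> S"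
    have e: "closest_point (X R) 0 = closest_point (X S) 0"
      using RS(3) unfolding q(2)[OF RS(1)] q(2)[OF RS(2)] g_def by (metis prod.inject)
    have "closest_point (X R) 0 \<in> X R" if "R \<in> O1" for R
      using xX[OF that] Cc by (intro closest_point_in_set) (auto simp: X_def compact_imp_closed)
    then have "closest_point (X R) 0 \<in> X R \<inter> X S" using RS e by (metis IntI)
    then show False using Xdisj RS by blast
  qed
  define P where "P = (\<lambda>(i, j). {(v, w). v \<in> T i \<and> w \<in> T j \<and> v \<inter> w \<noteq> {}})"
  have finP: "finite (P ij)" if "ij \<in> I \<times> I" for ij
  proof -
    have "P ij \<subseteq> T (fst ij) \<times> T (snd ij)" by (auto simp: P_def split: prod.splits)
    then show ?thesis using that finT[of "fst ij"] finT[of "snd ij"]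
      by (metis finite_cartesian_product finite_subset mem_Times_iff)
  qed
  have "g ` O1 \<subseteq> Sigma (I \<times> I) P"
  proof (rule image_subsetI)
    fix R assume R: "R \<in> O1"
    obtain i j where ij: "q R = (i, j)" by (cases "q R")
    have "i \<in> I" "j \<in> I" using q(1)[OF R] ij by auto
    moreover have "x R \<in> v R k" if "k \<in> I" for k
      using x[OF R] interior_subset v(2)[OF R] that by blast
    ultimately have "v R i \<inter> v R j \<noteq> {}" by blast
    then show "g R \<in> Sigma (I \<times> I) P"
      using v(1) R ij \<open>i \<in> I\<close> \<open>j \<in> I\<close> by (auto simp: g_def P_def)
  qed
  moreover have "finite (Sigma (I \<times> I) P)" using fin finP by blast
  ultimately have "card O1 \<le> card (Sigma (I \<times> I) P)"
    using inj card_inj_on_le by blast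
  also have "\<dots> = (\<Sum>ij\<in>I \<times> I. card (P ij))"
    using fin finP by (intro card_SigmaI) auto
  finally show "card (overlay_regions I T)
      \<le> (\<Sum>(i, j)\<in>I \<times> I. card {(v, w). v \<in> T i \<and> w \<in> T j \<and> v \<inter> w \<noteq> {}})"
    by (simp add: O1_def P_def case_prod_unfold)
qed

subsection \<open>Packing and Voronoi cells\<close>

lemma dist_le_dist_iff_inner:
  fixes x a b :: "'a::real_inner"
  shows "dist x a \<le> dist x b \<longleftrightarrow> (b - a) \<bullet> x \<le> (b \<bullet> b - a \<bullet> a) / 2"
proof -
  have "dist x a \<le> dist x b \<longleftrightarrow> (x - a) \<bullet> (x - a) \<le> (x - b) \<bullet> (x - b)"
    by (simp add: dist_norm norm_le)
  also have "\<dots> \<longleftrightarrow> (b - a) \<bullet> x \<le> (b \<bullet> b - a \<bullet> a) / 2"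
    by (simp add: inner_diff_left inner_diff_right inner_commute algebra_simps)
  finally show ?thesis .
qed

lemma convex_voronoi_domain: "convex (voronoi_domain B a)"
proof -
  have "voronoi_domain B a = (\<Inter>b\<in>B. {x. (b - a) \<bullet> x \<le> (b \<bullet> b - a \<bullet> a) / 2})"
    by (auto simp: voronoi_domain_def dist_le_dist_iff_inner)
  then show ?thesis by (simp only: convex_INT convex_halfspace_le)
qed

text \<open>Two cells meet only on the bisector of their sites, a line, which has empty
  interior.\<close>

lemma interior_voronoi_domain_disjoint:
  assumes "a \<in> B" "b \<in> B" "a \<noteq> b"
  shows "interior (voronoi_domain B a) \<inter> interior (voronoi_domain B b) = {}"
proof -
  have "voronoi_domain B a \<inter> voronoi_domain B b \<subseteq> {x. (b - a) \<bullet> x = (b \<bullet> b - a \<bullet> a) / 2}"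
  proof
    fix x assume x: "x \<in> voronoi_domain B a \<inter> voronoi_domain B b"
    then have "dist x a \<le> dist x b" "dist x b \<le> dist x a"
      using assms by (auto simp: voronoi_domain_def)
    then show "x \<in> {x. (b - a) \<bullet> x = (b \<bullet> b - a \<bullet> a) / 2}"
      by (simp add: dist_le_dist_iff_inner inner_diff_left field_simps)
  qed
  then have "interior (voronoi_domain B a \<inter> voronoi_domain B b)
      \<subseteq> interior {x. (b - a) \<bullet> x = (b \<bullet> b - a \<bullet> a) / 2}"
    by (rule interior_mono)
  also have "\<dots> = {}" using assms by (intro interior_hyperplane) simp
  finally show ?thesis by simp
qed

section \<open>Packing by a square grid\<close>

text \<open>Side length \<open>1/3\<close> makes the diameter of a square less than
  \<open>1/2\<close>, the separation that half segments of different cells will have.\<close>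

definition grid_cell :: "real^2 \<Rightarrow> int \<times> int" where
  "grid_cell p = (\<lfloor>3 * p $ 1\<rfloor>, \<lfloor>3 * p $ 2\<rfloor>)"

lemma dist_less_half_if_grid_cell_eq:
  assumes "grid_cell p = grid_cell q"
  shows "dist p q < 1 / 2"
proof -
  have lt: "\<bar>u - v\<bar> < 1 / 3" if "\<lfloor>3 * u\<rfloor> = \<lfloor>3 * v\<rfloor>" for u v :: real
    using that by linarith
  have "\<bar>p $ 1 - q $ 1\<bar> < 1 / 3" "\<bar>p $ 2 - q $ 2\<bar> < 1 / 3"
    using assms lt[of "p $ 1" "q $ 1"] lt[of "p $ 2" "q $ 2"] by (auto simp: grid_cell_def)
  then have "(p $ 1 - q $ 1)\<^sup>2 \<le> (1 / 3)\<^sup>2" "(p $ 2 - q $ 2)\<^sup>2 \<le> (1 / 3)\<^sup>2"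
    by (simp_all add: abs_le_square_iff[symmetric])
  then have "(p $ 1 - q $ 1)\<^sup>2 + (p $ 2 - q $ 2)\<^sup>2 < (1 / 2)\<^sup>2"
    by (simp add: power2_eq_square)
  then have "sqrt ((p $ 1 - q $ 1)\<^sup>2 + (p $ 2 - q $ 2)\<^sup>2) < 1 / 2"
    by (intro real_less_lsqrt) auto
  then show ?thesis
    by (simp add: dist_norm norm_vec_def L2_set_def sum_2)
qed

lemma grid_cells_cball:
  fixes c :: "real^2"
  assumes "R \<ge> 1"
  shows "finite (grid_cell ` cball c R)" and "real (card (grid_cell ` cball c R)) \<le> 64 * R\<^sup>2"
proof -
  define J where "J i = {\<lfloor>3 * (c $ i - R)\<rfloor> .. \<lfloor>3 * (c $ i + R)\<rfloor>}" for i
  have cJ: "real (card (J i)) \<le> 8 * R" for i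
  proof -
    have "\<lfloor>3 * (c $ i + R)\<rfloor> \<ge> \<lfloor>3 * (c $ i - R)\<rfloor>"
      using assms by (intro floor_mono) simp
    then have "real (card (J i)) = real_of_int (\<lfloor>3 * (c $ i + R)\<rfloor> + 1 - \<lfloor>3 * (c $ i - R)\<rfloor>)"
      by (simp add: J_def)
    also have "\<dots> \<le> 3 * (c $ i + R) + 1 - (3 * (c $ i - R) - 1)"
      by linarith
    \<comment> \<open>The left side is \<open>6 * R + 2\<close>.\<close>
    also have "\<dots> \<le> 8 * R" using assms by simp
    finally show ?thesis .
  qed
  have sub: "grid_cell ` cball c R \<subseteq> J 1 \<times> J 2"
  proof (rule image_subsetI)
    fix p assume p: "p \<in> cball c R"
    have "\<bar>c $ i - p $ i\<bar> \<le> R" for i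
      using p component_le_norm_cart[of "c - p" i] by (simp add: dist_norm)
    then have "\<lfloor>3 * p $ i\<rfloor> \<in> J i" for i
      unfolding J_def atLeastAtMost_iff by (intro conjI floor_mono) (smt (verit))+
    then show "grid_cell p \<in> J 1 \<times> J 2" by (simp add: grid_cell_def)
  qed
  have fin: "finite (J 1 \<times> J 2)" by (simp add: J_def)
  then show "finite (grid_cell ` cball c R)" using sub finite_subset by blast
  have "real (card (grid_cell ` cball c R)) \<le> real (card (J 1 \<times> J 2))"
    using sub fin card_mono by (metis of_nat_le_iff)
  also have "\<dots> = real (card (J 1)) * real (card (J 2))"
    by (simp add: card_cartesian_product)
  also have "\<dots> \<le> (8 * R) * (8 * R)"
    using cJ assms by (intro mult_mono) auto
  finally show "real (card (grid_cell ` cball c R)) \<le> 64 * R\<^sup>2"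
    by (simp add: power2_eq_square)
qed

lemma card_le_if_separated:
  fixes f :: "'i \<Rightarrow> real^2"
  assumes "R \<ge> 1" and sub: "f ` I \<subseteq> cball c R"
    and sep: "\<And>i j. i \<in> I \<Longrightarrow> j \<in> I \<Longrightarrow> i \<noteq> j \<Longrightarrow> dist (f i) (f j) \<ge> 1 / 2"
  shows "real (card I) \<le> 64 * R\<^sup>2"
proof -
  have "inj_on (grid_cell \<circ> f) I"
    using sep dist_less_half_if_grid_cell_eq by (fastforce intro: inj_onI)
  moreover have "(grid_cell \<circ> f) ` I \<subseteq> grid_cell ` cball c R"
    using sub by auto
  ultimately have "card I \<le> card (grid_cell ` cball c R)"
    using grid_cells_cball(1)[OF assms(1)] card_inj_on_le by blast
  then show ?thesis using grid_cells_cball(2)[OF assms(1), of c] by linarith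
qed

text \<open>The signed distance to the bisector of two sites is affine, at least \<open>1/2\<close> at the own site and
  nonnegative on the own cell, hence at least \<open>1/4\<close> on the half of the segment next to the site.\<close>

lemma voronoi_half_segments_separated:
  assumes ab: "a \<in> P" "b \<in> P" "dist a b \<ge> 1"
    and x: "x \<in> voronoi_domain P a" and y: "y \<in> voronoi_domain P b"
    and t: "0 \<le> t" "t \<le> 1 / 2" and u: "0 \<le> u" "u \<le> 1 / 2"
  shows "dist (a + t *\<^sub>R (x - a)) (b + u *\<^sub>R (y - b)) \<ge> 1 / 2"
proof -
  define d where "d = dist a b"
  define e where "e = a - b"
  define p q where "p = a + t *\<^sub>R (x - a)" and "q = b + u *\<^sub>R (y - b)"
  have d: "d \<ge> 1" "norm e = d" "e \<bullet> e = d * d"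
    using ab by (auto simp: d_def e_def dist_norm norm_eq_sqrt_inner)
  \<comment> \<open>For any point \<open>v\<close>, \<open>e \<bullet> v - s\<close> is
    \<open>d\<close> times the signed distance of \<open>v\<close> from the bisector, positive on
    the side of \<open>a\<close>.\<close>
  define s where "s = (a \<bullet> a - b \<bullet> b) / 2"
  have "dist x a \<le> dist x b" "dist y b \<le> dist y a"
    using x y ab by (auto simp: voronoi_domain_def)
  then have ex: "e \<bullet> x \<ge> s" and ey: "e \<bullet> y \<le> s"
    by (auto simp: dist_le_dist_iff_inner s_def e_def inner_diff_left field_simps)
  have "e \<bullet> e = 2 * (e \<bullet> a - s)" "e \<bullet> e = 2 * (s - e \<bullet> b)"
    by (auto simp: e_def s_def inner_diff_left inner_diff_right inner_commute field_simps)
  then have ea: "e \<bullet> a - s = d * d / 2" and eb: "s - e \<bullet> b = d * d / 2"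
    using d by auto
  have "e \<bullet> p - s = (1 - t) * (e \<bullet> a - s) + t * (e \<bullet> x - s)"
    by (simp add: p_def inner_add_right inner_diff_right algebra_simps)
  also have "\<dots> \<ge> (1 / 2) * (d * d / 2) + 0"
    unfolding ea using t ex by (intro add_mono mult_right_mono) auto
  finally have 1: "e \<bullet> p - s \<ge> d * d / 4" by simp
  have "s - e \<bullet> q = (1 - u) * (s - e \<bullet> b) + u * (s - e \<bullet> y)"
    by (simp add: q_def inner_add_right inner_diff_right algebra_simps)
  also have "\<dots> \<ge> (1 / 2) * (d * d / 2) + 0"
    unfolding eb using u ey by (intro add_mono mult_right_mono) auto
  finally have 2: "s - e \<bullet> q \<ge> d * d / 4" by simp
  have "d * (d / 2) \<le> e \<bullet> (p - q)"
    using 1 2 by (simp add: inner_diff_right)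
  also have "\<dots> \<le> d * norm (p - q)"
    using norm_cauchy_schwarz[of e "p - q"] d by simp
  finally have "d / 2 \<le> norm (p - q)"
    using d by simp
  then show ?thesis using d by (simp add: p_def q_def dist_norm)
qed

subsection \<open>Pairs of meeting Voronoi cells\<close>

text \<open>The segment from a site to its point \<open>x a\<close> carries \<open>n + 1\<close>
  points at unit spacing, starting at the site and staying in the half next to it. All these points,
  over all sites in \<open>F\<close>, are \<open>1/2\<close>-separated and lie in one disc of radius
  \<open>R\<close>. With \<open>n\<close> of order \<open>R\<close> this leaves only
  \<open>O(R)\<close> sites.\<close>

lemma card_deep_voronoi_cells_le:
  assumes sep: "\<And>a b. a \<in> P \<Longrightarrow> b \<in> P \<Longrightarrow> a \<noteq> b \<Longrightarrow> dist a b \<ge> 1"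
    and F: "F \<subseteq> P" and x: "\<And>a. a \<in> F \<Longrightarrow> x a \<in> voronoi_domain P a"
    and deep: "\<And>a. a \<in> F \<Longrightarrow> 2 * real n \<le> dist (x a) a"
    and near: "\<And>a. a \<in> F \<Longrightarrow> dist c a + real n \<le> R" and R: "R \<ge> 1"
  shows "real (card F) * (real n + 1) \<le> 64 * R\<^sup>2"
proof -
  define f where "f = (\<lambda>(a, k::nat). a + (real k / dist (x a) a) *\<^sub>R (x a - a))"
  have fa: "dist (f (a, k)) (f (a, l)) = \<bar>real k - real l\<bar>" if "a \<in> F" "k \<le> n" "l \<le> n" for a k l
  proof (cases "dist (x a) a = 0")
    \<comment> \<open>Here \<open>deep\<close> forces \<open>n = 0\<close>, so the division by zero
      only concerns the site itself.\<close>
    case True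
    then show ?thesis using deep[OF that(1)] that by (simp add: f_def)
  next
    case False
    have "f (a, k) - f (a, l) = ((real k - real l) / dist (x a) a) *\<^sub>R (x a - a)"
      by (simp add: f_def diff_divide_distrib algebra_simps)
    then have "dist (f (a, k)) (f (a, l)) = \<bar>(real k - real l) / dist (x a) a\<bar> * dist (x a) a"
      by (simp add: dist_norm)
    then show ?thesis using False by simp
  qed
  have f0: "f (a, 0) = a" for a by (simp add: f_def)
  have "real (card (F \<times> {..n})) \<le> 64 * R\<^sup>2"
  proof (rule card_le_if_separated[OF R])
    show "f ` (F \<times> {..n}) \<subseteq> cball c R"
    proof clarify
      fix a k assume a: "a \<in> F" "k \<le> n"
      have "dist c (f (a, k)) \<le> dist c a + dist (f (a, 0)) (f (a, k))"
        unfolding f0 by (rule dist_triangle)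
      also have "\<dots> = dist c a + real k" using fa[of a 0 k] a by simp
      also have "\<dots> \<le> R" using near[of a] a by simp
      finally show "f (a, k) \<in> cball c R" by simp
    qed
    fix i j assume ij: "i \<in> F \<times> {..n}" "j \<in> F \<times> {..n}" "i \<noteq> j"
    obtain a k b l where [simp]: "i = (a, k)" "j = (b, l)" by (cases i, cases j)
    have in_half: "0 \<le> real k / dist (x a) a \<and> real k / dist (x a) a \<le> 1 / 2"
      if "a \<in> F" "k \<le> n" for a k
      using deep[OF that(1)] that by (cases "x a = a") (auto simp: field_simps)
    show "dist (f i) (f j) \<ge> 1 / 2"
    proof (cases "a = b")
      case True
      then have "\<bar>real k - real l\<bar> \<ge> 1" using ij by auto
      then show ?thesis using fa[of a k l] ij True by simp
    next
      case False
      have "dist (a + (real k / dist (x a) a) *\<^sub>R (x a - a))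
          (b + (real l / dist (x b) b) *\<^sub>R (x b - b)) \<ge> 1 / 2"
        using ij F sep[of a b] False x in_half[of a k] in_half[of b l]
        by (intro voronoi_half_segments_separated[where P = P]) auto
      then show ?thesis by (simp add: f_def)
    qed
  qed
  then show ?thesis by (simp add: card_cartesian_product algebra_simps)
qed

text \<open>Double counting of charges: a grid cell receives at most \<open>64 * 23\<^sup>2\<close>,
  and there are at most \<open>64 * R\<^sup>2\<close> cells. The assumption \<open>le\<close>
  guarantees that the segment to \<open>b\<close> has room for a number of points proportional to
  the distance from \<open>x\<close> to \<open>a\<close>.\<close>

lemma card_near_pairs_le:
  fixes x :: "(real^2) \<times> (real^2) \<Rightarrow> real^2"
  assumes sepP: "\<And>a b. a \<in> P \<Longrightarrow> b \<in> P \<Longrightarrow> a \<noteq> b \<Longrightarrow> dist a b \<ge> 1"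
    and sepQ: "\<And>a b. a \<in> Q \<Longrightarrow> b \<in> Q \<Longrightarrow> a \<noteq> b \<Longrightarrow> dist a b \<ge> 1"
    and S: "S \<subseteq> P \<times> Q" "finite S"
    and xP: "\<And>a b. (a, b) \<in> S \<Longrightarrow> x (a, b) \<in> voronoi_domain P a"
    and xQ: "\<And>a b. (a, b) \<in> S \<Longrightarrow> x (a, b) \<in> voronoi_domain Q b"
    and le: "\<And>a b. (a, b) \<in> S \<Longrightarrow> dist (x (a, b)) a \<le> dist (x (a, b)) b"
    and bd: "\<And>a b. (a, b) \<in> S \<Longrightarrow> norm (x (a, b)) \<le> R \<and> norm b \<le> R" and R: "R \<ge> 1"
  shows "real (card S) \<le> 64 * 23\<^sup>2 * (64 * R\<^sup>2)"
proof -
  \<comment> \<open>The pair \<open>(a, b)\<close> distributes a unit charge over the grid cells of the \<open>n + 1\<close> points \<open>tok\<close> at unit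
    spacing on the segment from \<open>b\<close> to \<open>x\<close>, going from its midpoint towards \<open>b\<close>. Doubling the
    distance of such a point from \<open>b\<close> leads to a point that is close to \<open>x\<close>.\<close>
  define r where "r \<pi> = dist (x \<pi>) (fst \<pi>)" for \<pi>
  \<comment> \<open>The divisor 8 keeps every doubled point within \<open>r \<pi> / 4\<close> of
    \<open>x \<pi>\<close>, a fraction small enough to solve for \<open>r \<pi>\<close> when two
    pairs are compared.\<close>
  define n where "n \<pi> = nat \<lfloor>r \<pi> / 8\<rfloor>" for \<pi>
  \<comment> \<open>If \<open>x \<pi>\<close> equals the site \<open>snd \<pi>\<close>, then
    \<open>t \<pi> k\<close> defaults to \<open>1/2\<close>; for pairs in \<open>S\<close> only
    \<open>k = 0\<close> occurs in that case.\<close>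
  define t where "t \<pi> k = 1 / 2 - real k / dist (x \<pi>) (snd \<pi>)" for \<pi> and k :: nat
  define tok where "tok \<pi> k = snd \<pi> + t \<pi> k *\<^sub>R (x \<pi> - snd \<pi>)" for \<pi> k
  define Z where "Z \<pi> = (grid_cell \<circ> tok \<pi>) ` {..n \<pi>}" for \<pi>
  have r0: "r \<pi> \<ge> 0" for \<pi> by (simp add: r_def)
  have n: "real (n \<pi>) \<le> r \<pi> / 8" "r \<pi> / 8 < real (n \<pi>) + 1" for \<pi>
    using r0[of \<pi>] unfolding n_def by linarith+
  have rD: "r \<pi> \<le> dist (x \<pi>) (snd \<pi>)" if "\<pi> \<in> S" for \<pi>
    using le that by (cases \<pi>) (auto simp: r_def)
  have t: "0 \<le> t \<pi> k" "t \<pi> k \<le> 1 / 2" if "\<pi> \<in> S" "k \<le> n \<pi>" for \<pi> k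
  proof -
    have "8 * real k \<le> dist (x \<pi>) (snd \<pi>)"
      using rD[OF that(1)] n(1)[of \<pi>] that(2) by linarith
    then show "0 \<le> t \<pi> k" "t \<pi> k \<le> 1 / 2"
      by (cases "dist (x \<pi>) (snd \<pi>) = 0"; simp add: t_def field_simps)+
  qed
  have tok_dist: "dist (tok \<pi> k) (tok \<pi> l) = \<bar>real k - real l\<bar>"
    if "\<pi> \<in> S" "k \<le> n \<pi>" "l \<le> n \<pi>" for \<pi> k l
  proof (cases "dist (x \<pi>) (snd \<pi>) = 0")
    case True
    then have "n \<pi> = 0" using rD[OF that(1)] r0[of \<pi>] n(1)[of \<pi>] by simp
    then show ?thesis using that by simp
  next
    case False
    have "tok \<pi> k - tok \<pi> l = ((real l - real k) / dist (x \<pi>) (snd \<pi>)) *\<^sub>R (x \<pi> - snd \<pi>)"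
      by (simp add: tok_def t_def diff_divide_distrib algebra_simps)
    then have "dist (tok \<pi> k) (tok \<pi> l) =
        \<bar>(real l - real k) / dist (x \<pi>) (snd \<pi>)\<bar> * dist (x \<pi>) (snd \<pi>)"
      by (simp add: dist_norm)
    then show ?thesis using False by simp
  qed
  have cardZ: "card (Z \<pi>) = n \<pi> + 1" if "\<pi> \<in> S" for \<pi>
  proof -
    have "inj_on (grid_cell \<circ> tok \<pi>) {..n \<pi>}"
    proof (rule inj_onI)
      fix k l assume kl: "k \<in> {..n \<pi>}" "l \<in> {..n \<pi>}"
        "(grid_cell \<circ> tok \<pi>) k = (grid_cell \<circ> tok \<pi>) l"
      then have "\<bar>real k - real l\<bar> < 1 / 2"
        using dist_less_half_if_grid_cell_eq[of "tok \<pi> k" "tok \<pi> l"] tok_dist[OF that] by simp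
      then show "k = l" by linarith
    qed
    then show ?thesis unfolding Z_def by (simp only: card_image card_atMost Suc_eq_plus1)
  qed
  define G where "G = grid_cell ` cball (0::real^2) R"
  have ZG: "Z \<pi> \<subseteq> G" if "\<pi> \<in> S" for \<pi>
  proof -
    have "tok \<pi> k \<in> cball 0 R" if k: "k \<le> n \<pi>" for k
    proof -
      have "tok \<pi> k = (1 - t \<pi> k) *\<^sub>R snd \<pi> + t \<pi> k *\<^sub>R x \<pi>"
        by (simp add: tok_def algebra_simps)
      moreover have "snd \<pi> \<in> cball 0 R" "x \<pi> \<in> cball 0 R"
        using bd that k \<open>\<pi> \<in> S\<close> by (cases \<pi>; auto)+
      ultimately show ?thesis
        using convexD_alt[OF convex_cball, of "snd \<pi>" 0 R "x \<pi>" "t \<pi> k"] t[OF \<open>\<pi> \<in> S\<close> k] by simp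
    qed
    then show ?thesis by (auto simp: Z_def G_def)
  qed
  have finG: "finite G" unfolding G_def by (rule grid_cells_cball(1)[OF R])
  have cell: "(\<Sum>\<pi> | \<pi> \<in> S \<and> g \<in> Z \<pi>. 1 / (real (n \<pi>) + 1)) \<le> 64 * 23\<^sup>2" for g
  proof -
    define F where "F = {\<pi> \<in> S. g \<in> Z \<pi>}"
    have finF: "finite F" using S by (simp add: F_def)
    have FS: "\<pi> \<in> S" if "\<pi> \<in> F" for \<pi> using that by (simp add: F_def)
    show ?thesis
    proof (cases "F = {}")
      case True
      have "(\<Sum>\<pi>\<in>F. 1 / (real (n \<pi>) + 1)) \<le> 64 * 23\<^sup>2" unfolding True by simp
      then show ?thesis by (simp add: F_def)
    next
      case False
      have "Min (n ` F) \<in> n ` F" using False finF by simp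
      \<comment> \<open>A pair with the fewest points sets the scale \<open>q\<close>: every pair in
        \<open>F\<close> charges at most \<open>1 / q\<close> here, so \<open>card F = O(q)\<close>
        suffices.\<close>
      then obtain \<pi>0 where \<pi>0: "\<pi>0 \<in> F" "n \<pi>0 = Min (n ` F)" by auto
      have nmin: "n \<pi>0 \<le> n \<pi>" if "\<pi> \<in> F" for \<pi>
        using that finF \<pi>0 by simp
      define q where "q = real (n \<pi>0) + 1"
      have q1: "q \<ge> 1" by (simp add: q_def)
      have r\<pi>0: "r \<pi>0 < 8 * q" using n(2)[of \<pi>0] by (simp add: q_def)
      have half: "\<exists>k\<le>n \<pi>. grid_cell (tok \<pi> k) = g" if "\<pi> \<in> F" for \<pi>
        using that by (auto simp: F_def Z_def)
      have x_tok: "norm (x \<pi> - (2 *\<^sub>R tok \<pi> k - snd \<pi>)) \<le> r \<pi> / 4" if "\<pi> \<in> S" "k \<le> n \<pi>" for \<pi> k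
      proof -
        have "x \<pi> - (2 *\<^sub>R tok \<pi> k - snd \<pi>) = 2 *\<^sub>R (tok \<pi> 0 - tok \<pi> k)"
          by (simp add: tok_def t_def algebra_simps scaleR_2)
        then have "norm (x \<pi> - (2 *\<^sub>R tok \<pi> k - snd \<pi>)) = 2 * dist (tok \<pi> 0) (tok \<pi> k)"
          by (simp add: dist_norm)
        also have "\<dots> = 2 * real k" using tok_dist[of \<pi> 0 k] that by simp
        also have "\<dots> \<le> r \<pi> / 4" using n(1)[of \<pi>] that by linarith
        finally show ?thesis .
      qed
      have props: "snd \<pi> = snd \<pi>0 \<and> dist (x \<pi>0) (x \<pi>) \<le> 7 * q \<and> r \<pi> \<le> 15 * q"
        if \<pi>: "\<pi> \<in> F" for \<pi>
      proof -
        obtain k l where kl: "k \<le> n \<pi>" "l \<le> n \<pi>0" "grid_cell (tok \<pi> k) = g" "grid_cell (tok \<pi>0 l) = g"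
          using half \<pi> \<pi>0 by blast
        then have close: "dist (tok \<pi> k) (tok \<pi>0 l) < 1 / 2"
          using dist_less_half_if_grid_cell_eq by metis
        have in_Q: "snd \<rho> \<in> Q" "x \<rho> \<in> voronoi_domain Q (snd \<rho>)" "fst \<rho> \<in> P"
            "x \<rho> \<in> voronoi_domain P (fst \<rho>)" if "\<rho> \<in> F" for \<rho>
          using FS[OF that] S xQ xP by (cases \<rho>; auto)+
        \<comment> \<open>Both points lie on the halves of their segments next to the
          \<open>Q\<close>-sites; for different sites they would be at least \<open>1/2\<close>
          apart and could not share a grid cell.\<close>
        have same: "snd \<pi> = snd \<pi>0"
        proof (rule ccontr)
          assume ne: "snd \<pi> \<noteq> snd \<pi>0"
          have "dist (tok \<pi> k) (tok \<pi>0 l) \<ge> 1 / 2"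
            unfolding tok_def
            using ne in_Q \<pi> \<pi>0 sepQ t FS kl
            by (intro voronoi_half_segments_separated[where P = Q]) auto
          then show False using close by simp
        qed
        define y where "y = 2 *\<^sub>R tok \<pi> k - snd \<pi>"
        define y0 where "y0 = 2 *\<^sub>R tok \<pi>0 l - snd \<pi>0"
        have "dist y y0 = 2 * dist (tok \<pi> k) (tok \<pi>0 l)"
          unfolding y_def y0_def same dist_norm
          by (simp flip: scaleR_diff_right)
        then have "dist y y0 \<le> 1" using close by simp
        moreover have "dist (x \<pi>) y \<le> r \<pi> / 4" "dist (x \<pi>0) y0 \<le> r \<pi>0 / 4"
          using x_tok[of \<pi> k] x_tok[of \<pi>0 l] FS \<pi> \<pi>0 kl by (auto simp: y_def y0_def dist_norm)
        moreover have "dist (x \<pi>) (x \<pi>0) \<le> dist (x \<pi>) y + dist y y0 + dist (x \<pi>0) y0"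
          by metric
        ultimately have d: "dist (x \<pi>) (x \<pi>0) \<le> r \<pi> / 4 + r \<pi>0 / 4 + 1" by linarith
        \<comment> \<open>\<open>r \<pi>\<close> is the distance from \<open>x \<pi>\<close> to the
          whole of \<open>P\<close>, hence 1-Lipschitz in \<open>x \<pi>\<close>.\<close>
        have "r \<pi> \<le> dist (x \<pi>) (fst \<pi>0)"
          using in_Q[OF \<pi>] in_Q[OF \<pi>0(1)] by (auto simp: r_def voronoi_domain_def)
        also have "\<dots> \<le> dist (x \<pi>) (x \<pi>0) + r \<pi>0"
          unfolding r_def by (rule dist_triangle)
        finally have r: "r \<pi> \<le> dist (x \<pi>) (x \<pi>0) + r \<pi>0" .
        \<comment> \<open>Combining \<open>d\<close> and \<open>r\<close> gives
          \<open>3/4 * r \<pi> \<le> 5/4 * r \<pi>0 + 1\<close>. With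
          \<open>r \<pi>0 < 8 * q\<close> and \<open>1 \<le> q\<close> this yields
          \<open>r \<pi> \<le> 44/3 * q\<close> and then a distance of at most
          \<open>20/3 * q\<close>.\<close>
        then show ?thesis
          using same d r\<pi>0 q1 by (simp add: dist_commute)
      qed
      define b where "b = snd \<pi>0"
      have F_eq: "(a, b) \<in> F" if "a \<in> fst ` F" for a
        using that props by (force simp: b_def)
      have inj: "inj_on fst F"
        using props by (metis inj_onI prod_eqI)
      \<comment> \<open>The radius is \<open>23 = 7 + 15 + 1\<close> times \<open>q\<close>: from
        \<open>x \<pi>0\<close> to \<open>x \<pi>\<close>, on to the site, and
        \<open>n \<pi>0\<close> more for the points along the segment.\<close>
      have "real (card (fst ` F)) * (real (n \<pi>0) + 1) \<le> 64 * (23 * q)\<^sup>2"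
      proof (rule card_deep_voronoi_cells_le[OF sepP, where x = "\<lambda>a. x (a, b)" and c = "x \<pi>0"])
        show "fst ` F \<subseteq> P" using FS S by force
        show "1 \<le> 23 * q" using q1 by simp
        fix a assume "a \<in> fst ` F"
        note ab = F_eq[OF this]
        show "x (a, b) \<in> voronoi_domain P a" using ab FS xP by blast
        show "2 * real (n \<pi>0) \<le> dist (x (a, b)) a"
          using nmin[OF ab] n(1)[of "(a, b)"] r0[of "(a, b)"] by (simp add: r_def)
        have "dist (x \<pi>0) a \<le> 7 * q + r (a, b)"
          using props[OF ab] dist_triangle[of "x \<pi>0" a "x (a, b)"]
          unfolding r_def fst_conv by linarith
        moreover have "r (a, b) \<le> 15 * q" using props[OF ab] by blast
        moreover have "real (n \<pi>0) \<le> q" by (simp add: q_def)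
        ultimately show "dist (x \<pi>0) a + real (n \<pi>0) \<le> 23 * q" by simp
      qed auto
      then have "real (card F) * q \<le> 64 * 23\<^sup>2 * q * q"
        using inj by (simp add: card_image q_def power2_eq_square algebra_simps)
      then have cF: "real (card F) \<le> 64 * 23\<^sup>2 * q" using q1 by simp
      have "(\<Sum>\<pi>\<in>F. 1 / (real (n \<pi>) + 1)) \<le> (\<Sum>\<pi>\<in>F. 1 / q)"
        using nmin q1 by (intro sum_mono divide_left_mono) (auto simp: q_def)
      also have "\<dots> = real (card F) / q" by simp
      also have "\<dots> \<le> 64 * 23\<^sup>2" using cF q1 by (simp add: divide_le_eq)
      finally show ?thesis by (simp add: F_def)
    qed
  qed
  \<comment> \<open>Each pair hands out total charge 1, over exactly \<open>n \<pi> + 1\<close>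
    different grid cells.\<close>
  have "real (card S) = (\<Sum>\<pi>\<in>S. \<Sum>g\<in>Z \<pi>. 1 / (real (n \<pi>) + 1))"
    using cardZ by (simp add: add.commute)
  also have "\<dots> = (\<Sum>\<pi>\<in>S. \<Sum>g | g \<in> G \<and> g \<in> Z \<pi>. 1 / (real (n \<pi>) + 1))"
    using ZG by (intro sum.cong refl) blast
  also have "\<dots> = (\<Sum>g\<in>G. \<Sum>\<pi> | \<pi> \<in> S \<and> g \<in> Z \<pi>. 1 / (real (n \<pi>) + 1))"
    by (rule sum.swap_restrict[OF S(2) finG])
  also have "\<dots> \<le> (\<Sum>g\<in>G. 64 * 23\<^sup>2)"
    by (intro sum_mono cell)
  also have "\<dots> = 64 * 23\<^sup>2 * real (card G)" by simp
  also have "\<dots> \<le> 64 * 23\<^sup>2 * (64 * R\<^sup>2)"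
    unfolding G_def by (intro mult_left_mono grid_cells_cball(2)[OF R]) simp
  finally show ?thesis .
qed

section \<open>From near pairs to all pairs of meeting cells\<close>

text \<open>A common point is chosen for each pair. If it has norm at most \<open>2 * M\<close>, the
  charging bound applies, with \<open>P\<close> and \<open>Q\<close> exchanged when the site in
  \<open>Q\<close> is the nearer one. Otherwise both cells reach far out, and each class has only
  \<open>O(M)\<close> such cells.\<close>

lemma card_meeting_voronoi_cells_le_normalized:
  assumes sepP: "\<And>a b. a \<in> P \<Longrightarrow> b \<in> P \<Longrightarrow> a \<noteq> b \<Longrightarrow> dist a b \<ge> 1"
    and sepQ: "\<And>a b. a \<in> Q \<Longrightarrow> b \<in> Q \<Longrightarrow> a \<noteq> b \<Longrightarrow> dist a b \<ge> 1"
    and fin: "finite P" "finite Q" and bd: "P \<subseteq> cball 0 M" "Q \<subseteq> cball 0 M" and M: "M \<ge> 1"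
  shows "real (card {(a, b). a \<in> P \<and> b \<in> Q \<and> voronoi_domain P a \<inter> voronoi_domain Q b \<noteq> {}})
    \<le> 2 ^ 25 * M\<^sup>2"
proof -
  define S where "S = {(a, b). a \<in> P \<and> b \<in> Q \<and> voronoi_domain P a \<inter> voronoi_domain Q b \<noteq> {}}"
  have SPQ: "S \<subseteq> P \<times> Q" by (auto simp: S_def)
  then have finS: "finite S" using fin finite_subset by blast
  have "\<forall>\<pi>\<in>S. \<exists>z. z \<in> voronoi_domain P (fst \<pi>) \<inter> voronoi_domain Q (snd \<pi>)"
    by (auto simp: S_def)
  from bchoice[OF this] obtain x where
    x: "\<And>\<pi>. \<pi> \<in> S \<Longrightarrow> x \<pi> \<in> voronoi_domain P (fst \<pi>) \<inter> voronoi_domain Q (snd \<pi>)"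
    by blast
  have PQ: "fst \<pi> \<in> P" "snd \<pi> \<in> Q" "norm (fst \<pi>) \<le> M" "norm (snd \<pi>) \<le> M" if "\<pi> \<in> S" for \<pi>
    using that SPQ bd by (cases \<pi>; auto)+
  define N1 where "N1 = {\<pi> \<in> S. norm (x \<pi>) \<le> 2 * M \<and> dist (x \<pi>) (fst \<pi>) \<le> dist (x \<pi>) (snd \<pi>)}"
  define N2 where "N2 = {\<pi> \<in> S. norm (x \<pi>) \<le> 2 * M \<and> dist (x \<pi>) (snd \<pi>) \<le> dist (x \<pi>) (fst \<pi>)}"
  define E where "E = {\<pi> \<in> S. norm (x \<pi>) > 2 * M}"
  have 1: "real (card N1) \<le> 64 * 23\<^sup>2 * (64 * (2 * M)\<^sup>2)"
  proof (rule card_near_pairs_le[OF sepP sepQ])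
    show "N1 \<subseteq> P \<times> Q" "finite N1" "2 * M \<ge> 1"
      using SPQ finS M by (auto simp: N1_def)
    fix a b assume "(a, b) \<in> N1"
    then show "x (a, b) \<in> voronoi_domain P a" "x (a, b) \<in> voronoi_domain Q b"
        "dist (x (a, b)) a \<le> dist (x (a, b)) b" "norm (x (a, b)) \<le> 2 * M \<and> norm b \<le> 2 * M"
      using x[of "(a, b)"] PQ[of "(a, b)"] M by (auto simp: N1_def)
  qed
  have 2: "real (card N2) \<le> 64 * 23\<^sup>2 * (64 * (2 * M)\<^sup>2)"
  proof -
    have "card N2 = card (prod.swap ` N2)"
      by (simp add: card_image)
    moreover have "real (card (prod.swap ` N2)) \<le> 64 * 23\<^sup>2 * (64 * (2 * M)\<^sup>2)"
    proof (rule card_near_pairs_le[OF sepQ sepP, where x = "x \<circ> prod.swap"])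
      show "prod.swap ` N2 \<subseteq> Q \<times> P" "finite (prod.swap ` N2)" "2 * M \<ge> 1"
        using SPQ finS M by (auto simp: N2_def)
      fix b a assume "(b, a) \<in> prod.swap ` N2"
      then have "(a, b) \<in> N2" by auto
      then show "(x \<circ> prod.swap) (b, a) \<in> voronoi_domain Q b"
          "(x \<circ> prod.swap) (b, a) \<in> voronoi_domain P a"
          "dist ((x \<circ> prod.swap) (b, a)) b \<le> dist ((x \<circ> prod.swap) (b, a)) a"
          "norm ((x \<circ> prod.swap) (b, a)) \<le> 2 * M \<and> norm a \<le> 2 * M"
        using x[of "(a, b)"] PQ[of "(a, b)"] M by (auto simp: N2_def)
    qed
    ultimately show ?thesis by simp
  qed
  \<comment> \<open>A point of norm above \<open>2 * M\<close> is more than \<open>M\<close> away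
    from its site, which allows about \<open>M / 2\<close> points per segment inside the disc of
    radius \<open>2 * M\<close>; \<open>512 = 64 * 4 * 2\<close>.\<close>
  have deep: "real (card F) \<le> 512 * M"
    if sep: "\<And>a b. a \<in> A \<Longrightarrow> b \<in> A \<Longrightarrow> a \<noteq> b \<Longrightarrow> dist a b \<ge> 1"
      and F: "F \<subseteq> A" and A: "A \<subseteq> cball 0 M"
      and far: "\<forall>a\<in>F. \<exists>y. y \<in> voronoi_domain A a \<and> norm y > 2 * M" for A F :: "(real^2) set"
  proof -
    from bchoice[OF far] obtain y where
      y: "\<And>a. a \<in> F \<Longrightarrow> y a \<in> voronoi_domain A a" "\<And>a. a \<in> F \<Longrightarrow> norm (y a) > 2 * M"
      by blast
    define n where "n = nat \<lfloor>M / 2\<rfloor>"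
    have n: "real n \<le> M / 2" "M / 2 \<le> real n + 1"
      using M unfolding n_def by linarith+
    have nF: "norm a \<le> M" if "a \<in> F" for a using that F A by auto
    have "real (card F) * (real n + 1) \<le> 64 * (2 * M)\<^sup>2"
    proof (rule card_deep_voronoi_cells_le[OF sep F, where x = y and c = 0])
      fix a assume a: "a \<in> F"
      show "2 * real n \<le> dist (y a) a"
        using n nF[OF a] y(2)[OF a] norm_triangle_ineq2[of "y a" a] by (simp add: dist_norm)
      show "dist 0 a + real n \<le> 2 * M"
        using n nF[OF a] M by simp
    qed (use y M in auto)
    moreover have "real (card F) * (M / 2) \<le> real (card F) * (real n + 1)"
      using n by (intro mult_left_mono) auto
    ultimately have "real (card F) * M \<le> 512 * M * M" by (simp add: power2_eq_square)
    then show ?thesis using M by simp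
  qed
  have "card E \<le> card (fst ` E \<times> snd ` E)"
    using finS by (intro card_mono) (force simp: E_def)+
  then have "real (card E) \<le> real (card (fst ` E)) * real (card (snd ` E))"
    by (metis card_cartesian_product of_nat_le_iff of_nat_mult)
  also have "\<dots> \<le> (512 * M) * (512 * M)"
  proof (rule mult_mono)
    show "real (card (fst ` E)) \<le> 512 * M"
    proof (rule deep[OF sepP _ bd(1)])
      show "fst ` E \<subseteq> P" using PQ by (auto simp: E_def)
      show "\<forall>a\<in>fst ` E. \<exists>y. y \<in> voronoi_domain P a \<and> norm y > 2 * M"
      proof (rule ballI, erule imageE)
        fix a \<pi> assume "a = fst \<pi>" "\<pi> \<in> E"
        then show "\<exists>y. y \<in> voronoi_domain P a \<and> norm y > 2 * M"
          using x[of \<pi>] by (intro exI[of _ "x \<pi>"]) (auto simp: E_def)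
      qed
    qed
    show "real (card (snd ` E)) \<le> 512 * M"
    proof (rule deep[OF sepQ _ bd(2)])
      show "snd ` E \<subseteq> Q" using PQ by (auto simp: E_def)
      show "\<forall>b\<in>snd ` E. \<exists>y. y \<in> voronoi_domain Q b \<and> norm y > 2 * M"
      proof (rule ballI, erule imageE)
        fix b \<pi> assume "b = snd \<pi>" "\<pi> \<in> E"
        then show "\<exists>y. y \<in> voronoi_domain Q b \<and> norm y > 2 * M"
          using x[of \<pi>] by (intro exI[of _ "x \<pi>"]) (auto simp: E_def)
      qed
    qed
  qed (use M in auto)
  finally have 3: "real (card E) \<le> 262144 * M\<^sup>2" by (simp add: power2_eq_square)
  have "S \<subseteq> N1 \<union> N2 \<union> E" by (auto simp: N1_def N2_def E_def)
  then have "card S \<le> card (N1 \<union> N2 \<union> E)"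
    using finS by (intro card_mono) (auto simp: N1_def N2_def E_def)
  also have "\<dots> \<le> card N1 + card N2 + card E"
    by (metis add_le_mono1 card_Un_le order_trans)
  finally have "real (card S) \<le> real (card N1) + real (card N2) + real (card E)"
    by linarith
  \<comment> \<open>The constant is \<open>2 * (64 * 23^2 * 64 * 4) + 512^2\<close>.\<close>
  also have "\<dots> \<le> 17596416 * M\<^sup>2"
    using 1 2 3 by (simp add: power_mult_distrib)
  also have "\<dots> \<le> 2 ^ 25 * M\<^sup>2"
    by (intro mult_right_mono) auto
  finally show ?thesis by (simp add: S_def)
qed

text \<open>The similarity \<open>h\<close> moves \<open>z\<close> to the origin and the separation
  \<open>d\<close> to 1. It preserves comparisons of distances, so it carries meeting cells to
  meeting cells.\<close>

lemma card_meeting_voronoi_cells_le: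
  assumes d: "d > 0"
    and sepP: "\<And>a b. a \<in> P \<Longrightarrow> b \<in> P \<Longrightarrow> a \<noteq> b \<Longrightarrow> dist a b \<ge> d"
    and sepQ: "\<And>a b. a \<in> Q \<Longrightarrow> b \<in> Q \<Longrightarrow> a \<noteq> b \<Longrightarrow> dist a b \<ge> d"
    and fin: "finite P" "finite Q" and bd: "P \<subseteq> cball z (d * M)" "Q \<subseteq> cball z (d * M)"
    and M: "M \<ge> 1"
  shows "real (card {(a, b). a \<in> P \<and> b \<in> Q \<and> voronoi_domain P a \<inter> voronoi_domain Q b \<noteq> {}})
    \<le> 2 ^ 25 * M\<^sup>2"
proof -
  define h where "h = (\<lambda>x. (1 / d) *\<^sub>R (x - z))"
  have dist_h: "dist (h x) (h y) = dist x y / d" for x y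
  proof -
    have "h x - h y = (1 / d) *\<^sub>R (x - y)" by (simp add: h_def algebra_simps)
    then show ?thesis using d by (simp add: dist_norm)
  qed
  have inj: "inj h" using d by (auto intro!: injI simp: h_def)
  have hV: "h x \<in> voronoi_domain (h ` B) (h a)" if "x \<in> voronoi_domain B a" for x B a
    using that d by (auto simp: voronoi_domain_def dist_h divide_right_mono)
  have sep: "dist a b \<ge> 1"
    if "\<And>a b. a \<in> B \<Longrightarrow> b \<in> B \<Longrightarrow> a \<noteq> b \<Longrightarrow> dist a b \<ge> d" "a \<in> h ` B" "b \<in> h ` B" "a \<noteq> b"
    for a b B
    using that d by (fastforce simp: dist_h)
  have ball: "h ` B \<subseteq> cball 0 M" if "B \<subseteq> cball z (d * M)" for B
    using that d by (auto simp: h_def dist_norm norm_minus_commute divide_le_eq mult.commute)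
  define S where "S P Q = {(a, b). a \<in> P \<and> b \<in> Q \<and> voronoi_domain P a \<inter> voronoi_domain Q b \<noteq> {}}"
    for P Q
  have "map_prod h h ` S P Q \<subseteq> S (h ` P) (h ` Q)"
    using hV by (fastforce simp: S_def)
  moreover have "inj_on (map_prod h h) (S P Q)"
    using inj by (meson inj_on_subset prod.inj_map subset_UNIV)
  moreover have "finite (S (h ` P) (h ` Q))"
    by (rule finite_subset[of _ "(h ` P) \<times> (h ` Q)"]) (use fin in \<open>auto simp: S_def\<close>)
  ultimately have "card (S P Q) \<le> card (S (h ` P) (h ` Q))"
    using card_inj_on_le by blast
  moreover have "real (card (S (h ` P) (h ` Q))) \<le> 2 ^ 25 * M\<^sup>2"
    unfolding S_def
    by (rule card_meeting_voronoi_cells_le_normalized)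
      (use sep[OF sepP] sep[OF sepQ] fin ball bd M in auto)
  ultimately show ?thesis unfolding S_def by linarith
qed

text \<open>Passes from pairs of sites to pairs of cells. An empty class has the plane as its only
  cell, just as the one-point set \<open>{z}\<close> does, and may be replaced by it.\<close>

lemma card_meeting_Vor_le:
  assumes d: "d > 0"
    and sepP: "\<And>a b. a \<in> P \<Longrightarrow> b \<in> P \<Longrightarrow> a \<noteq> b \<Longrightarrow> dist a b \<ge> d"
    and sepQ: "\<And>a b. a \<in> Q \<Longrightarrow> b \<in> Q \<Longrightarrow> a \<noteq> b \<Longrightarrow> dist a b \<ge> d"
    and fin: "finite P" "finite Q" and bd: "P \<subseteq> cball z (d * M)" "Q \<subseteq> cball z (d * M)"
    and M: "M \<ge> 1"
  shows "real (card {(v, w). v \<in> Vor P \<and> w \<in> Vor Q \<and> v \<inter> w \<noteq> {}}) \<le> 2 ^ 25 * M\<^sup>2"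
proof -
  define P' where "P' = (if P = {} then {z} else P)"
  define Q' where "Q' = (if Q = {} then {z} else Q)"
  have Vor: "Vor B = voronoi_domain B' ` B'" if "B' = (if B = {} then {z} else B)" for B B'
    using that by (auto simp: Vor_def voronoi_domain_def)
  define S where "S = {(a, b). a \<in> P' \<and> b \<in> Q' \<and> voronoi_domain P' a \<inter> voronoi_domain Q' b \<noteq> {}}"
  have "{(v, w). v \<in> Vor P \<and> w \<in> Vor Q \<and> v \<inter> w \<noteq> {}}
      \<subseteq> map_prod (voronoi_domain P') (voronoi_domain Q') ` S"
    unfolding Vor[OF P'_def] Vor[OF Q'_def] by (force simp: S_def)
  moreover have finS: "finite S"
    by (rule finite_subset[of _ "P' \<times> Q'"]) (use fin in \<open>auto simp: S_def P'_def Q'_def\<close>)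
  ultimately have "card {(v, w). v \<in> Vor P \<and> w \<in> Vor Q \<and> v \<inter> w \<noteq> {}} \<le> card S"
    by (meson card_image_le card_mono finite_imageI order_trans)
  moreover have "real (card S) \<le> 2 ^ 25 * M\<^sup>2"
    unfolding S_def
  proof (rule card_meeting_voronoi_cells_le[OF d _ _ _ _ _ _ M])
    show "P' \<subseteq> cball z (d * M)" "Q' \<subseteq> cball z (d * M)" "finite P'" "finite Q'"
      using bd d M fin by (auto simp: P'_def Q'_def)
  qed (use sepP sepQ in \<open>auto simp: P'_def Q'_def split: if_splits\<close>)
  ultimately show ?thesis by linarith
qed

section \<open>The bound for coloured point sets\<close>

theorem mainTheorem10:
  "\<exists>K::real. \<forall>(A::(real^2) set) (s::nat) (c::real^2 \<Rightarrow> nat).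
     finite A \<longrightarrow> card A \<ge> 2 \<longrightarrow> s \<ge> 1 \<longrightarrow> c \<in> A \<rightarrow> {0..s} \<longrightarrow>
       finite (overlay_regions {0..s} (\<lambda>j. Vor (color_class A c j))) \<and>
       real (card (overlay_regions {0..s} (\<lambda>j. Vor (color_class A c j))))
         \<le> K * (real s)\<^sup>2 * (point_density A)\<^sup>2"
proof (intro exI[of _ "2 ^ 27"] allI impI)
  fix A :: "(real^2) set" and s :: nat and c :: "real^2 \<Rightarrow> nat"
  assume A: "finite A" "card A \<ge> 2" and s: "s \<ge> 1"
  define d where "d = Min (distances A)"
  define M where "M = point_density A"
  have "distances A \<subseteq> (\<lambda>(x, y). dist x y) ` (A \<times> A)"
    by (auto simp: distances_def)
  then have finD: "finite (distances A)" using A finite_subset by blast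
  obtain z y where zy: "z \<in> A" "y \<in> A" "z \<noteq> y"
    using A(2) by (metis card_le_Suc0_iff_eq A(1) not_less_eq_eq numeral_2_eq_2)
  then have neD: "distances A \<noteq> {}" by (auto simp: distances_def)
  have "d \<in> distances A" unfolding d_def by (rule Min_in[OF finD neD])
  then have d: "d > 0" by (auto simp: distances_def)
  have sep: "d \<le> dist a b" if "a \<in> A" "b \<in> A" "a \<noteq> b" for a b
    unfolding d_def using finD that by (intro Min_le) (auto simp: distances_def)
  have dM: "d * M = Max (distances A)"
    using d by (simp add: M_def point_density_def d_def)
  have "d * 1 \<le> d * M"
    unfolding dM using finD \<open>d \<in> distances A\<close> by simp
  then have M: "M \<ge> 1" using d by simp
  \<comment> \<open>The disc around a point of \<open>A\<close> whose radius is the diameter;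
    measured in units of the least distance \<open>d\<close>, this radius is the density.\<close>
  have bd: "A \<subseteq> cball z (d * M)"
  proof
    fix a assume a: "a \<in> A"
    show "a \<in> cball z (d * M)"
    proof (cases "a = z")
      case False
      then have "dist z a \<in> distances A" using a zy by (auto simp: distances_def)
      then show ?thesis unfolding dM using finD by simp
    qed (use d M in auto)
  qed
  define T where "T j = Vor (color_class A c j)" for j
  have sub: "color_class A c j \<subseteq> A" for j by (auto simp: color_class_def)
  have finc: "finite (color_class A c j)" for j using sub A finite_subset by blast
  have finT: "finite (T j)" for j
    using finc by (simp add: T_def Vor_def)
  have convT: "convex v" if "v \<in> T j" for j v
    using that by (auto simp: T_def Vor_def convex_voronoi_domain split: if_splits)
  have disjT: "interior v \<inter> interior w = {}" if "v \<in> T j" "w \<in> T j" "v \<noteq> w" for j v w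
    using that interior_voronoi_domain_disjoint
    by (auto simp: T_def Vor_def split: if_splits)
  have pair: "real (card {(v, w). v \<in> T i \<and> w \<in> T j \<and> v \<inter> w \<noteq> {}}) \<le> 2 ^ 25 * M\<^sup>2" for i j
    unfolding T_def
    by (rule card_meeting_Vor_le[OF d _ _ finc finc _ _ M, where z = z])
      (use sep sub bd in blast)+
  note regions = overlay_regions_card_le[of "{0..s}" T, OF _ _ finT convT disjT]
  have "real (card (overlay_regions {0..s} T))
      \<le> (\<Sum>(i, j)\<in>{0..s} \<times> {0..s}. real (card {(v, w). v \<in> T i \<and> w \<in> T j \<and> v \<inter> w \<noteq> {}}))"
    using regions(2) by (simp add: case_prod_unfold flip: of_nat_sum)
  also have "\<dots> \<le> (\<Sum>(i, j)\<in>{0..s} \<times> {0..s}. 2 ^ 25 * M\<^sup>2)"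
    using pair by (intro sum_mono) auto
  also have "\<dots> = (real s + 1)\<^sup>2 * (2 ^ 25 * M\<^sup>2)"
    by (simp add: power2_eq_square algebra_simps)
  \<comment> \<open>Since \<open>s \<ge> 1\<close>, the \<open>s + 1\<close> colours number at most
    \<open>2 * s\<close>; the factor 4 turns \<open>2 ^ 25\<close> into
    \<open>2 ^ 27\<close>.\<close>
  also have "\<dots> \<le> (2 * real s)\<^sup>2 * (2 ^ 25 * M\<^sup>2)"
    using s by (intro mult_right_mono power_mono) auto
  also have "\<dots> = 2 ^ 27 * (real s)\<^sup>2 * (point_density A)\<^sup>2"
    by (simp add: M_def power_mult_distrib)
  finally have "real (card (overlay_regions {0..s} T)) \<le> 2 ^ 27 * (real s)\<^sup>2 * (point_density A)\<^sup>2" .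
  moreover have "finite (overlay_regions {0..s} T)" using regions(1) by simp
  moreover have "T = (\<lambda>j. Vor (color_class A c j))" by (simp add: T_def fun_eq_iff)
  ultimately show "finite (overlay_regions {0..s} (\<lambda>j. Vor (color_class A c j))) \<and>
       real (card (overlay_regions {0..s} (\<lambda>j. Vor (color_class A c j))))
         \<le> 2 ^ 27 * (real s)\<^sup>2 * (point_density A)\<^sup>2" by simp
qed

end
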